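(* For all real numbers $\varrho$, every element $(X,\|\cdot\|)$ of $\mathsf{pdBW}_\varrho$ is an angle space with respect to the angle $\angle_\varrho$, i.e. $(X,\|\cdot\|,\angle_\varrho)$ is an angle space.
   Context: A balancedly weighted vector space ($\mathsf{BW}$ space) $(X,\|\cdot\|)$ is a real topological vector space $X$ with a continuous map $\|\cdot\|:X\to[0,\infty)$ (the weight) such that $\|r\cdot\vec x\|=|r|\cdot\|\vec x\|$ for all $r\in\mathbb{R}$, $\vec x\in X$. The triangle inequality is not assumed. It is positive definite if $\|\vec x\|=0$ holds only for $\vec x=\vec 0$. Let $\mathsf{pdBW}$ be the class of all positive definite $\mathsf{BW}$ spaces. Let $(X,\|\cdot\|)\in\mathsf{pdBW}$ and $\varrho\in\mathbb{R}$. For $\vec x,\vec y\in X\setminus\{\vec 0\}$ put $\mathbf{s}=\left\|\frac{\vec x}{\|\vec x\|}+\frac{\vec y}{\|\vec y\|}\right\|$, $\mathbf{d}=\left\|\frac{\vec x}{\|\vec x\|}-\frac{\vec y}{\|\vec y\|}\right\|$, $\mathbf{\Sigma}=\mathbf{s}^2+\mathbf{d}^2$ (which is $>0$), $\mathbf{\Delta}=\mathbf{s}^2-\mathbf{d}^2$, and $\langle\vec x\,|\,\vec y\rangle_\varrho=\|\vec x\|\cdot\|\vec y\|\cdot\frac14\mathbf{\Delta}\cdot\left(\frac14\mathbf{\Sigma}\right)^{\varrho}$; put $\langle\vec x\,|\,\vec y\rangle_\varrho=0$ if $\vec x=\vec 0$ or $\vec y=\vec 0$. The space $(X,\|\cdot\|)$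 "has the angle $\angle_\varrho$" if $|\langle\vec x\,|\,\vec y\rangle_\varrho|\le\|\vec x\|\cdot\|\vec y\|$ for all $\vec x,\vec y\in X$; then $\angle_\varrho(\vec x,\vec y):=\arccos\frac{\langle\vec x|\vec y\rangle_\varrho}{\|\vec x\|\|\vec y\|}$ is defined for all $\vec x,\vec y\ne\vec 0$. Let $\mathsf{pdBW}_\varrho$ be the class of all $(X,\|\cdot\|)\in\mathsf{pdBW}$ that have the angle $\angle_\varrho$. For a positive definite $\mathsf{BW}$ space $(X,\|\cdot\|)$, a triple $(X,\|\cdot\|,\angle_X)$ is an angle space if the following hold for all $\vec x,\vec y\in X\setminus\{\vec 0\}$: (An 1) $\angle_X$ is a continuous map from $(X\setminus\{\vec 0\})^2$ into $[0,\pi]$; (An 2) $\angle_X(\vec x,\vec x)=0$; (An 3) $\angle_X(-\vec x,\vec x)=\pi$; (An 4) $\angle_X(\vec x,\vec y)=\angle_X(\vec y,\vec x)$; (An 5) $\angle_X(r\vec x,s\vec y)=\angle_X(\vec x,\vec y)$ for all $r,s>0$; (An 6) $\angle_X(-\vec x,-\vec y)=\angle_X(\vec x,\vec y)$; (An 7) $\angle_X(\vec x,\vec y)+\angle_X(-\vec x,\vec y)=\pi$. *)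

theory Defs
  imports "HOL-Analysis.Analysis"
begin

(* Real topological vector spaces; no separation axiom is imposed. *)
class topological_real_vector = real_vector + topological_ab_group_add +
  assumes tendsto_scaleR_Pair:
    "LIM p (nhds r \<times>\<^sub>F nhds x). fst p *\<^sub>R snd p :> nhds (r *\<^sub>R x)"

instance real_normed_vector \<subseteq> topological_real_vector
proof
  fix r :: real and x :: 'a
  show "LIM p (nhds r \<times>\<^sub>F nhds x). fst p *\<^sub>R snd p :> nhds (r *\<^sub>R x)"
    by (intro tendsto_scaleR filterlim_fst filterlim_snd)
qed

definition BW :: "('a :: topological_real_vector \<Rightarrow> real) \<Rightarrow> bool" where
  "BW w \<longleftrightarrow> continuous_on UNIV w \<and> (\<forall>x. 0 \<le> w x) \<and> (\<forall>r x. w (r *\<^sub>R x) = \<bar>r\<bar> * w x)"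

definition pdBW :: "('a :: topological_real_vector \<Rightarrow> real) \<Rightarrow> bool" where
  "pdBW w \<longleftrightarrow> BW w \<and> (\<forall>x. w x = 0 \<longrightarrow> x = 0)"

definition bw_s :: "('a :: topological_real_vector \<Rightarrow> real) \<Rightarrow> 'a \<Rightarrow> 'a \<Rightarrow> real" where
  "bw_s w x y = w (x /\<^sub>R w x + y /\<^sub>R w y)"

definition bw_d :: "('a :: topological_real_vector \<Rightarrow> real) \<Rightarrow> 'a \<Rightarrow> 'a \<Rightarrow> real" where
  "bw_d w x y = w (x /\<^sub>R w x - y /\<^sub>R w y)"

definition bw_Sigma :: "('a :: topological_real_vector \<Rightarrow> real) \<Rightarrow> 'a \<Rightarrow> 'a \<Rightarrow> real" where
  "bw_Sigma w x y = (bw_s w x y)\<^sup>2 + (bw_d w x y)\<^sup>2"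

definition bw_Delta :: "('a :: topological_real_vector \<Rightarrow> real) \<Rightarrow> 'a \<Rightarrow> 'a \<Rightarrow> real" where
  "bw_Delta w x y = (bw_s w x y)\<^sup>2 - (bw_d w x y)\<^sup>2"

definition bw_product ::
    "real \<Rightarrow> ('a :: topological_real_vector \<Rightarrow> real) \<Rightarrow> 'a \<Rightarrow> 'a \<Rightarrow> real" where
  "bw_product \<rho> w x y =
     (if x = 0 \<or> y = 0 then 0
      else w x * w y * (1/4 * bw_Delta w x y) * (1/4 * bw_Sigma w x y) powr \<rho>)"

definition has_bw_angle :: "real \<Rightarrow> ('a :: topological_real_vector \<Rightarrow> real) \<Rightarrow> bool" where
  "has_bw_angle \<rho> w \<longleftrightarrow> (\<forall>x y. \<bar>bw_product \<rho> w x y\<bar> \<le> w x * w y)"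

(* Meaningful only for nonzero x and y, and for weights satisfying has_bw_angle. *)
definition bw_angle ::
    "real \<Rightarrow> ('a :: topological_real_vector \<Rightarrow> real) \<Rightarrow> 'a \<Rightarrow> 'a \<Rightarrow> real" where
  "bw_angle \<rho> w x y = arccos (bw_product \<rho> w x y / (w x * w y))"

definition pdBW_angle :: "real \<Rightarrow> ('a :: topological_real_vector \<Rightarrow> real) \<Rightarrow> bool" where
  "pdBW_angle \<rho> w \<longleftrightarrow> pdBW w \<and> has_bw_angle \<rho> w"

(* The angle is a total function here; only its values on pairs of nonzero vectors are constrained. *)
locale angle_space =
  fixes w :: "'a :: topological_real_vector \<Rightarrow> real"
    and ang :: "'a \<Rightarrow> 'a \<Rightarrow> real"
  assumes pdBW: "pdBW w"
    and continuous: "continuous_on ((- {0}) \<times> (- {0})) (\<lambda>(x, y). ang x y)"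
    and range: "x \<noteq> 0 \<Longrightarrow> y \<noteq> 0 \<Longrightarrow> ang x y \<in> {0..pi}"
    and self: "x \<noteq> 0 \<Longrightarrow> ang x x = 0"
    and opposite: "x \<noteq> 0 \<Longrightarrow> ang (- x) x = pi"
    and symmetric: "x \<noteq> 0 \<Longrightarrow> y \<noteq> 0 \<Longrightarrow> ang x y = ang y x"
    and scale: "x \<noteq> 0 \<Longrightarrow> y \<noteq> 0 \<Longrightarrow> 0 < r \<Longrightarrow> 0 < s \<Longrightarrow> ang (r *\<^sub>R x) (s *\<^sub>R y) = ang x y"
    and minus_both: "x \<noteq> 0 \<Longrightarrow> y \<noteq> 0 \<Longrightarrow> ang (- x) (- y) = ang x y"
    and supplement: "x \<noteq> 0 \<Longrightarrow> y \<noteq> 0 \<Longrightarrow> ang x y + ang (- x) y = pi"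

end

theory Submission
  imports Defs
begin

text \<open>
  Away from the zero vector, the cosine of the angle is
  \<open>\<Delta>/4 \<cdot> (\<Sigma>/4) powr \<rho>\<close>, and \<open>\<Delta>\<close> and \<open>\<Sigma>\<close> see a pair of vectors only through the two
  normalised vectors \<open>x / w x\<close> and \<open>y / w y\<close>. Each algebraic axiom of an angle space then comes
  from a symmetry of \<open>s\<close> and \<open>d\<close>. Positive scaling does not change the normalised vectors.
  Exchanging the two vectors, or negating both, leaves \<open>s\<close> and \<open>d\<close> alone because \<open>w\<close> is even.
  Negating one vector exchanges \<open>s\<close> and \<open>d\<close>, so that \<open>\<Sigma>\<close> is kept and \<open>\<Delta>\<close> changes its sign; the
  cosine is negated, and its arc cosine is replaced by its supplement. For equal vectors \<open>s = 2\<close>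
  and \<open>d = 0\<close>, whence \<open>\<Sigma>/4 = \<Delta>/4 = 1\<close> and the cosine is \<open>1\<close> whatever the exponent.

  Continuity needs one more idea, since a real power may be discontinuous at base \<open>0\<close>: the base
  \<open>\<Sigma>/4\<close> stays positive. Positive definiteness of \<open>w\<close> gives this, by forcing \<open>x = 0\<close> if \<open>s = d = 0\<close>
  (lemma \<open>bw_Sigma_pos\<close>). The assumption that the space has the angle puts the
  cosine into \<open>[-1, 1]\<close>, where the arc cosine is continuous, takes values in \<open>[0, \<pi>]\<close>, and
  satisfies the supplement rule.
\<close>

text \<open>
  The class axiom states joint continuity of scalar multiplication with product filters; this
  form lets continuity of composite functions be derived by the usual introduction rules.
\<close>

lemma tendsto_scaleR_topological:
  fixes g :: "'b \<Rightarrow> 'a :: topological_real_vector"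
  assumes "(f \<longlongrightarrow> r) F" and "(g \<longlongrightarrow> x) F"
  shows "((\<lambda>t. f t *\<^sub>R g t) \<longlongrightarrow> r *\<^sub>R x) F"
  using filterlim_compose[OF tendsto_scaleR_Pair filterlim_Pair[OF assms]] by simp

lemma continuous_on_scaleR_topological:
  fixes g :: "'b :: topological_space \<Rightarrow> 'a :: topological_real_vector"
  assumes "continuous_on S f" and "continuous_on S g"
  shows "continuous_on S (\<lambda>t. f t *\<^sub>R g t)"
  using assms unfolding continuous_on_def by (blast intro: tendsto_scaleR_topological)

lemma BW_scaleR: "BW w \<Longrightarrow> w (r *\<^sub>R x) = \<bar>r\<bar> * w x"
  by (simp add: BW_def)

lemma BW_zero: "BW w \<Longrightarrow> w 0 = 0"
  using BW_scaleR[of w 0 0] by simp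

lemma BW_minus: "BW w \<Longrightarrow> w (- x) = w x"
  using BW_scaleR[of w "-1" x] by simp

lemma BW_minus_commute: "BW w \<Longrightarrow> w (x - y) = w (y - x)"
  using BW_minus[of w "x - y"] by simp

lemma BW_continuous_on:
  assumes "BW w" and "continuous_on S f"
  shows "continuous_on S (\<lambda>t. w (f t))"
  using assms continuous_on_compose2[of UNIV w S f] by (simp add: BW_def)

lemma pdBW_imp_BW: "pdBW w \<Longrightarrow> BW w"
  by (simp add: pdBW_def)

lemma pdBW_pos: "pdBW w \<Longrightarrow> x \<noteq> 0 \<Longrightarrow> 0 < w x"
  by (metis BW_def less_eq_real_def pdBW_def)

text \<open>
  If \<open>\<Sigma>\<close> vanished, the sum and the difference of the two normalised vectors would both have
  weight \<open>0\<close> and hence be \<open>0\<close>, so that twice the first vector would vanish.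
\<close>

lemma bw_Sigma_pos:
  assumes pd: "pdBW w" and "x \<noteq> 0"
  shows "0 < bw_Sigma w x y"
proof (rule ccontr)
  let ?u = "x /\<^sub>R w x" and ?v = "y /\<^sub>R w y"
  assume "\<not> 0 < bw_Sigma w x y"
  then have "w (?u + ?v) = 0" "w (?u - ?v) = 0"
    unfolding bw_Sigma_def bw_s_def bw_d_def by (simp_all add: sum_power2_gt_zero_iff)
  then have "?u + ?v = 0" "?u - ?v = 0"
    using pd by (auto simp: pdBW_def)
  moreover have "2 *\<^sub>R ?u = (?u + ?v) + (?u - ?v)"
    by (simp only: scaleR_2) (simp add: algebra_simps)
  ultimately have "2 *\<^sub>R ?u = 0"
    by (metis add_0)
  then show False
    using pdBW_pos[OF assms] \<open>x \<noteq> 0\<close> by simp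
qed

text \<open>
  Without the factor \<open>w x * w y\<close> of the product, what remains depends only on directions.
\<close>

definition bw_cos ::
    "real \<Rightarrow> ('a :: topological_real_vector \<Rightarrow> real) \<Rightarrow> 'a \<Rightarrow> 'a \<Rightarrow> real" where
  "bw_cos \<rho> w x y = (1/4 * bw_Delta w x y) * (1/4 * bw_Sigma w x y) powr \<rho>"

lemma bw_product_eq_bw_cos:
  assumes "x \<noteq> 0" and "y \<noteq> 0"
  shows "bw_product \<rho> w x y = w x * w y * bw_cos \<rho> w x y"
  using assms by (simp add: bw_product_def bw_cos_def)

lemma bw_angle_eq_arccos:
  assumes "pdBW w" and "x \<noteq> 0" and "y \<noteq> 0"
  shows "bw_angle \<rho> w x y = arccos (bw_cos \<rho> w x y)"
  using assms pdBW_pos[of w x] pdBW_pos[of w y] by (simp add: bw_angle_def bw_product_eq_bw_cos)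

lemma abs_bw_cos_le_1:
  assumes pd: "pdBW w" and ang: "has_bw_angle \<rho> w" and "x \<noteq> 0" and "y \<noteq> 0"
  shows "\<bar>bw_cos \<rho> w x y\<bar> \<le> 1"
proof -
  have pos: "0 < w x * w y"
    using assms by (simp add: pdBW_pos)
  have "\<bar>w x * w y * bw_cos \<rho> w x y\<bar> \<le> w x * w y"
    using ang bw_product_eq_bw_cos[OF assms(3,4), of \<rho> w] unfolding has_bw_angle_def by metis
  then have "w x * w y * \<bar>bw_cos \<rho> w x y\<bar> \<le> w x * w y * 1"
    by (simp only: abs_mult[of "w x * w y"] abs_of_pos[OF pos] mult_1_right)
  then show ?thesis
    using pos by (simp only: mult_le_cancel_left_pos)
qed

lemma bw_cos_commute:
  assumes "BW w"
  shows "bw_cos \<rho> w x y = bw_cos \<rho> w y x"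
proof -
  have "bw_s w x y = bw_s w y x"
    by (simp add: bw_s_def add.commute)
  moreover have "bw_d w x y = bw_d w y x"
    unfolding bw_d_def by (rule BW_minus_commute[OF assms])
  ultimately show ?thesis
    by (simp add: bw_cos_def bw_Delta_def bw_Sigma_def)
qed

lemma bw_s_minus_left:
  assumes "BW w"
  shows "bw_s w (- x) y = bw_d w x y"
  using BW_minus_commute[OF assms, of "x /\<^sub>R w x" "y /\<^sub>R w y"]
  by (simp add: bw_s_def bw_d_def BW_minus[OF assms])

lemma bw_d_minus_left:
  assumes "BW w"
  shows "bw_d w (- x) y = bw_s w x y"
  using bw_s_minus_left[OF assms, of "- x" y] by simp

lemma bw_cos_minus_left: "BW w \<Longrightarrow> bw_cos \<rho> w (- x) y = - bw_cos \<rho> w x y"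
  by (simp add: bw_cos_def bw_Delta_def bw_Sigma_def bw_s_minus_left bw_d_minus_left
      algebra_simps)

lemma bw_cos_minus_both:
  assumes "BW w"
  shows "bw_cos \<rho> w (- x) (- y) = bw_cos \<rho> w x y"
  by (simp add: bw_cos_minus_left[OF assms] bw_cos_commute[OF assms, of \<rho> x "- y"]
      bw_cos_commute[OF assms, of \<rho> y x])

text \<open>Normalising forgets a positive factor.\<close>

lemma bw_cos_scaleR:
  assumes "BW w" and "0 < r" and "0 < t"
  shows "bw_cos \<rho> w (r *\<^sub>R x) (t *\<^sub>R y) = bw_cos \<rho> w x y"
proof -
  have "(q *\<^sub>R z) /\<^sub>R w (q *\<^sub>R z) = z /\<^sub>R w z" if "0 < q" for q z
    using that by (simp add: BW_scaleR[OF \<open>BW w\<close>])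
  then show ?thesis
    using assms by (simp only: bw_cos_def bw_Delta_def bw_Sigma_def bw_s_def bw_d_def)
qed

lemma bw_cos_self:
  assumes pd: "pdBW w" and "x \<noteq> 0"
  shows "bw_cos \<rho> w x x = 1"
proof -
  note BW = pdBW_imp_BW[OF pd]
  have "bw_s w x x = w (2 *\<^sub>R (x /\<^sub>R w x))"
    unfolding bw_s_def by (simp only: scaleR_2)
  also have "\<dots> = 2"
    using pdBW_pos[OF assms] by (simp only: BW_scaleR[OF BW]) simp
  finally have "bw_s w x x = 2" .
  moreover have "bw_d w x x = 0"
    by (simp add: bw_d_def BW_zero[OF BW])
  ultimately show ?thesis
    by (simp add: bw_cos_def bw_Delta_def bw_Sigma_def)
qed

lemma continuous_on_bw_cos:
  assumes pd: "pdBW w"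
  shows "continuous_on ((- {0}) \<times> (- {0})) (\<lambda>p. bw_cos \<rho> w (fst p) (snd p))"
proof -
  let ?S = "(- {0}) \<times> (- {0 :: 'a})"
  note BW = pdBW_imp_BW[OF pd]
  have weight_nonzero: "w (fst p) \<noteq> 0" "w (snd p) \<noteq> 0" if "p \<in> ?S" for p
    using that pdBW_pos[OF pd, of "fst p"] pdBW_pos[OF pd, of "snd p"] by auto
  have normalise:
    "continuous_on ?S (\<lambda>p. fst p /\<^sub>R w (fst p))" "continuous_on ?S (\<lambda>p. snd p /\<^sub>R w (snd p))"
    using weight_nonzero
    by (auto intro!: continuous_on_scaleR_topological continuous_on_inverse BW_continuous_on[OF BW]
        continuous_on_fst continuous_on_snd continuous_on_id)
  have s: "continuous_on ?S (\<lambda>p. bw_s w (fst p) (snd p))"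
    unfolding bw_s_def by (intro BW_continuous_on[OF BW] continuous_on_add normalise)
  have d: "continuous_on ?S (\<lambda>p. bw_d w (fst p) (snd p))"
    unfolding bw_d_def by (intro BW_continuous_on[OF BW] continuous_on_diff normalise)
  have Delta: "continuous_on ?S (\<lambda>p. bw_Delta w (fst p) (snd p))"
    unfolding bw_Delta_def by (intro continuous_on_diff continuous_on_power s d)
  have Sigma: "continuous_on ?S (\<lambda>p. bw_Sigma w (fst p) (snd p))"
    unfolding bw_Sigma_def by (intro continuous_on_add continuous_on_power s d)
  have Sigma_nonzero: "1/4 * bw_Sigma w (fst p) (snd p) \<noteq> 0" if "p \<in> ?S" for p
    using that bw_Sigma_pos[OF pd, of "fst p" "snd p"] by auto
  show ?thesis
    unfolding bw_cos_def
    by (intro continuous_on_mult continuous_on_powr continuous_on_const Delta Sigma ballI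
        Sigma_nonzero)
qed

theorem proposition4:
  fixes \<rho> :: real and w :: "'a :: topological_real_vector \<Rightarrow> real"
  assumes "pdBW_angle \<rho> w"
  shows "angle_space w (bw_angle \<rho> w)"
proof -
  have pd: "pdBW w" and has_angle: "has_bw_angle \<rho> w"
    using assms by (simp_all add: pdBW_angle_def)
  note BW = pdBW_imp_BW[OF pd]
  note angle_eq = bw_angle_eq_arccos[OF pd]
  have bounds: "- 1 \<le> bw_cos \<rho> w x y" "bw_cos \<rho> w x y \<le> 1" if "x \<noteq> 0" "y \<noteq> 0" for x y
    using abs_bw_cos_le_1[OF pd has_angle that] by auto
  have self: "bw_angle \<rho> w x x = 0" if "x \<noteq> 0" for x
    using that by (simp add: angle_eq bw_cos_self[OF pd])
  have supplement: "bw_angle \<rho> w x y + bw_angle \<rho> w (- x) y = pi" if "x \<noteq> 0" "y \<noteq> 0" for x y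
    using that bounds by (simp add: angle_eq bw_cos_minus_left[OF BW] arccos_minus)
  have continuous: "continuous_on ((- {0}) \<times> (- {0})) (\<lambda>(x, y). bw_angle \<rho> w x y)"
  proof -
    have "continuous_on ((- {0}) \<times> (- {0})) (\<lambda>p. arccos (bw_cos \<rho> w (fst p) (snd p)))"
      using bounds by (intro continuous_on_arccos continuous_on_bw_cos[OF pd]) auto
    moreover have "(\<lambda>(x, y). bw_angle \<rho> w x y) p = arccos (bw_cos \<rho> w (fst p) (snd p))"
      if "p \<in> (- {0}) \<times> (- {0})" for p
      using that by (cases p) (simp add: angle_eq)
    ultimately show ?thesis
      using continuous_on_cong[OF refl] by (metis (no_types, lifting))
  qed
  show ?thesis
  proof
    show "bw_angle \<rho> w x y \<in> {0..pi}" if "x \<noteq> 0" "y \<noteq> 0" for x y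
      using that bounds by (simp add: angle_eq arccos_lbound arccos_ubound)
    show "bw_angle \<rho> w (- x) x = pi" if "x \<noteq> 0" for x
      using supplement[OF that that] self[OF that] by simp
    show "bw_angle \<rho> w x y = bw_angle \<rho> w y x" if "x \<noteq> 0" "y \<noteq> 0" for x y
      using that by (simp add: angle_eq bw_cos_commute[OF BW, of \<rho> x y])
    show "bw_angle \<rho> w (r *\<^sub>R x) (t *\<^sub>R y) = bw_angle \<rho> w x y"
      if "x \<noteq> 0" "y \<noteq> 0" "0 < r" "0 < t" for x y r t
      using that by (simp add: angle_eq bw_cos_scaleR[OF BW])
    show "bw_angle \<rho> w (- x) (- y) = bw_angle \<rho> w x y" if "x \<noteq> 0" "y \<noteq> 0" for x y
      using that by (simp add: angle_eq bw_cos_minus_both[OF BW])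
  qed (fact pd continuous self supplement)+
qed

end
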